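(* Let $Q=(q_{ij})_{1\le i,j\le N}$ be an irreducible transition rate matrix with steady-state distribution $\mu=(\mu_1,\dots,\mu_N)$. There exists a constant $c_2>0$, depending only on $Q$, such that for every solution $p(t)=(p_1(t),\dots,p_N(t))$ of the master equation $\frac{dp}{dt}=pQ$ starting from a probability distribution $p(0)$, and every $t\ge0$, writing $p_i=p_i(t)$, the adiabatic entropy production rate $$e_p^{(ad)}=\frac12\sum_{i,j}(p_iq_{ij}-p_jq_{ji})\log\frac{\mu_iq_{ij}}{\mu_jq_{ji}}\in(-\infty,+\infty]$$ satisfies $$e_p^{(ad)} \;\ge\; c_2\sum_{i,j}p_i(\mu_iq_{ij}-\mu_jq_{ji})^2 .$$
   Context: Transition rate matrix on the finite state space $\{1,\dots,N\}$: a real matrix $Q=(q_{ij})$ with $q_{ij}\ge 0$ for $i\ne j$ and $q_{ii}=-\sum_{j\ne i}q_{ij}$. Irreducible: for each pair of states $i\neq j$ there is a sequence of states $i_1=i,i_2,\dots,i_m=j$ with $q_{i_1i_2}q_{i_2i_3}\cdots q_{i_{m-1}i_m}>0$. Under irreducibility there is a unique probability distribution $\mu$ with $\mu Q=0$ (the steady-state distribution), and all its components are positive. For any initial probability distribution $p(0)$, the solution $p(t)$ (a row vector) of $dp/dt=pQ$ is a probability distribution for all $t\ge 0$, and all its components are positive for $t>0$. Conventions in the definition of $e_p^{(ad)}$: $0/0=1$ inside the logarithm; $\log(a/0)=+\infty$ and $\log 0=-\infty$ for $a>0$; $0\cdot(\pm\infty)=0$. Thus every summand lies in $(-\infty,+\infty]$,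 and an infinite value $+\infty$ is allowed (the inequality is then trivially true). *)

theory Defs
  imports "HOL-Analysis.Analysis"
begin

text \<open>
  The state space \<open>{1, \<dots>, N}\<close> is an arbitrary finite index type \<open>'n\<close>; the entry \<open>q\<^sub>i\<^sub>j\<close> is
  \<open>Q $ i $ j\<close>, and a row vector acts on \<open>Q\<close> from the left through \<open>v*\<close>.
\<close>

definition transition_rate_matrix :: "real^'n^'n \<Rightarrow> bool" where
  "transition_rate_matrix Q \<longleftrightarrow>
     (\<forall>i j. i \<noteq> j \<longrightarrow> 0 \<le> Q $ i $ j) \<and>
     (\<forall>i. Q $ i $ i = - (\<Sum>j\<in>UNIV - {i}. Q $ i $ j))"

definition irreducible_rates :: "real^'n^'n \<Rightarrow> bool" where
  "irreducible_rates Q \<longleftrightarrow>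
     (\<forall>i j. i \<noteq> j \<longrightarrow>
       (\<exists>xs. xs \<noteq> [] \<and> hd xs = i \<and> last xs = j \<and>
             0 < (\<Prod>k<length xs - 1. Q $ (xs ! k) $ (xs ! Suc k))))"

definition prob_distribution :: "real^'n \<Rightarrow> bool" where
  "prob_distribution v \<longleftrightarrow> (\<forall>i. 0 \<le> v $ i) \<and> (\<Sum>i\<in>UNIV. v $ i) = 1"

definition steady_state :: "real^'n^'n \<Rightarrow> real^'n \<Rightarrow> bool" where
  "steady_state Q \<mu> \<longleftrightarrow> prob_distribution \<mu> \<and> \<mu> v* Q = 0"

definition master_solution :: "real^'n^'n \<Rightarrow> (real \<Rightarrow> real^'n) \<Rightarrow> bool" where
  "master_solution Q p \<longleftrightarrow>
     (\<forall>t\<ge>0. (p has_vector_derivative (p t v* Q)) (at t within {0..}))"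

text \<open>
  \<open>log_ratio a b\<close> is \<open>log (a / b)\<close> with \<open>0/0 = 1\<close>, \<open>log (a/0) = \<infinity>\<close> and \<open>log 0 = -\<infinity>\<close>. It is
  applied to \<open>\<mu>\<^sub>i q\<^sub>i\<^sub>j\<close> and \<open>\<mu>\<^sub>j q\<^sub>j\<^sub>i\<close>, which are both nonnegative unless \<open>i = j\<close>, where they
  are equal and the value is \<open>0\<close>.
\<close>

definition log_ratio :: "real \<Rightarrow> real \<Rightarrow> ereal" where
  "log_ratio a b =
     (if a = 0 \<and> b = 0 then 0
      else if b = 0 then \<infinity>
      else if a = 0 then - \<infinity>
      else ereal (ln (a / b)))"

text \<open>
  Multiplication on \<open>ereal\<close> satisfies \<open>0 * (\<plusminus>\<infinity>) = 0\<close>. For a nonnegative \<open>p\<close> no summand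
  is \<open>-\<infinity>\<close>, so the value \<open>\<infinity> + (-\<infinity>)\<close> that the library assigns plays no role.
\<close>

definition adiabatic_ep :: "real^'n^'n \<Rightarrow> real^'n \<Rightarrow> real^'n \<Rightarrow> ereal" where
  "adiabatic_ep Q \<mu> p =
     ereal (1 / 2) *
     (\<Sum>i\<in>UNIV. \<Sum>j\<in>UNIV.
        ereal (p $ i * Q $ i $ j - p $ j * Q $ j $ i) *
        log_ratio (\<mu> $ i * Q $ i $ j) (\<mu> $ j * Q $ j $ i))"

lemma adiabatic_summand_not_MInfty:
  assumes "transition_rate_matrix Q" "\<And>k. 0 < \<mu> $ k" "\<And>k. 0 \<le> p $ k"
  shows "ereal (p $ i * Q $ i $ j - p $ j * Q $ j $ i) *
           log_ratio (\<mu> $ i * Q $ i $ j) (\<mu> $ j * Q $ j $ i) \<noteq> - \<infinity>"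
proof (cases "i = j")
  case True
  then show ?thesis by (simp add: log_ratio_def)
next
  case False
  then have "0 \<le> Q $ i $ j" "0 \<le> Q $ j $ i"
    using assms(1) by (auto simp: transition_rate_matrix_def)
  moreover have "\<mu> $ i \<noteq> 0" "\<mu> $ j \<noteq> 0"
    using assms(2)[of i] assms(2)[of j] by auto
  moreover have "0 \<le> p $ i * Q $ i $ j" "0 \<le> p $ j * Q $ j $ i"
    using calculation assms(3) by auto
  ultimately show ?thesis
    by (auto simp: log_ratio_def)
qed

end

theory Submission
  imports Defs
begin

text \<open>
  With \<open>a\<^sub>i\<^sub>j = \<mu>\<^sub>i q\<^sub>i\<^sub>j\<close> and \<open>x\<^sub>i = p\<^sub>i / \<mu>\<^sub>i\<close>, antisymmetry of the logarithm turns a finite entropy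
  production rate into \<open>\<Sum>\<^sub>i x\<^sub>i \<Sum>\<^sub>j a\<^sub>i\<^sub>j log (a\<^sub>i\<^sub>j / a\<^sub>j\<^sub>i)\<close>. Rows of \<open>Q\<close> sum to zero and \<open>\<mu>\<close> is
  stationary, so all row sums and column sums of \<open>a\<close> vanish and the inner summand may be replaced
  by \<open>a\<^sub>i\<^sub>j log (a\<^sub>i\<^sub>j / a\<^sub>j\<^sub>i) - a\<^sub>i\<^sub>j + a\<^sub>j\<^sub>i\<close>. This is at least \<open>(\<surd>a\<^sub>i\<^sub>j - \<surd>a\<^sub>j\<^sub>i)\<^sup>2\<close>, which dominates
  \<open>(a\<^sub>i\<^sub>j - a\<^sub>j\<^sub>i)\<^sup>2 / (4M)\<close> for every bound \<open>M\<close> on the rates; finally \<open>x\<^sub>i \<ge> p\<^sub>i\<close> because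
  \<open>\<mu>\<^sub>i \<le> 1\<close>.
\<close>

section \<open>Two elementary estimates and identities for real sums\<close>

text \<open>Applying \<open>ln y \<le> y - 1\<close> to \<open>b / a\<close> gives only
  nonnegativity; applying it to \<open>sqrt b / sqrt a\<close> leaves the square of
  \<open>sqrt a - sqrt b\<close>.\<close>

lemma relative_entropy_ge_square:
  fixes a b M :: real
  assumes "0 < a" "0 < b" "a \<le> M" "b \<le> M"
  shows "(a - b)\<^sup>2 / (4 * M) \<le> a * ln (a / b) - a + b"
proof -
  define s t where "s = sqrt a" and "t = sqrt b"
  have st: "0 < s" "0 < t" "a = s\<^sup>2" "b = t\<^sup>2"
    using assms by (auto simp: s_def t_def)
  have "(s + t)\<^sup>2 \<le> 2 * (s\<^sup>2 + t\<^sup>2)"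
    using sum_squares_ge_zero[of "s - t" 0] by (simp add: power2_eq_square algebra_simps)
  also have "\<dots> \<le> 2 * (M + M)"
    using add_mono[OF assms(3,4)] by (simp add: st)
  finally have "(s + t)\<^sup>2 \<le> 4 * M"
    by simp
  then have "(s - t)\<^sup>2 * (s + t)\<^sup>2 \<le> (s - t)\<^sup>2 * (4 * M)"
    by (intro mult_left_mono) auto
  moreover have "(a - b)\<^sup>2 = (s - t)\<^sup>2 * (s + t)\<^sup>2"
    unfolding st by (simp add: power2_eq_square algebra_simps)
  ultimately have "(a - b)\<^sup>2 / (4 * M) \<le> (s - t)\<^sup>2"
    using assms by (simp add: divide_le_eq)
  also have "\<dots> \<le> a * ln (a / b) - a + b"
  proof -
    have "ln (t / s) \<le> t / s - 1"
      using st by (intro ln_le_minus_one) auto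
    then have "s\<^sup>2 * (2 * ln (t / s)) \<le> s\<^sup>2 * (2 * (t / s - 1))"
      by (intro mult_left_mono) auto
    also have "\<dots> = 2 * s * t - 2 * s\<^sup>2"
      using st by (simp add: power2_eq_square field_simps)
    finally have "s\<^sup>2 * (2 * ln (t / s)) \<le> 2 * s * t - 2 * s\<^sup>2" .
    moreover have "ln (a / b) = - (2 * ln (t / s))"
      using st by (simp add: ln_div ln_realpow)
    ultimately show ?thesis
      using st by (simp add: power2_eq_square algebra_simps)
  qed
  finally show ?thesis .
qed

text \<open>Swapping the indices turns the subtracted half into a second copy of the first. The
  resulting 2 cancels the 1/2 in \<open>adiabatic_ep\<close>.\<close>

lemma sum_antisymmetric_mult:
  fixes u l :: "'a \<Rightarrow> 'a \<Rightarrow> real"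
  assumes "\<And>i j. l j i = - l i j"
  shows "(\<Sum>i\<in>A. \<Sum>j\<in>A. (u i j - u j i) * l i j) = 2 * (\<Sum>i\<in>A. \<Sum>j\<in>A. u i j * l i j)"
proof -
  have "(\<Sum>i\<in>A. \<Sum>j\<in>A. u j i * l i j) = (\<Sum>i\<in>A. \<Sum>j\<in>A. u i j * l j i)"
    by (rule sum.swap)
  also have "\<dots> = - (\<Sum>i\<in>A. \<Sum>j\<in>A. u i j * l i j)"
    by (subst assms) (simp add: sum_negf)
  finally show ?thesis
    by (simp add: left_diff_distrib sum_subtractf)
qed

section \<open>Balance equations and positivity of the steady state\<close>

lemma rate_row_sum:
  assumes "transition_rate_matrix Q"
  shows "(\<Sum>j\<in>UNIV. Q $ i $ j) = 0"
  using assms sum.remove[of UNIV i "\<lambda>j. Q $ i $ j"]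
  by (simp add: transition_rate_matrix_def)

lemma steady_state_column_sum:
  assumes "steady_state Q \<mu>"
  shows "(\<Sum>i\<in>UNIV. \<mu> $ i * Q $ i $ j) = 0"
proof -
  have "(\<mu> v* Q) $ j = 0"
    using assms by (simp add: steady_state_def)
  then show ?thesis
    by (simp add: vector_matrix_mult_def mult.commute)
qed

text \<open>The only possibly negative term of the balance equation at \<open>j\<close> is the
  diagonal one, and \<open>\<mu> $ j = 0\<close> removes it. A vanishing sum of nonnegative terms
  then forces each inflow to vanish.\<close>

lemma steady_state_zero_backward:
  assumes "transition_rate_matrix Q" "steady_state Q \<mu>" "\<mu> $ j = 0" "Q $ i $ j \<noteq> 0"
  shows "\<mu> $ i = 0"
proof -
  have "\<forall>k\<in>UNIV. \<mu> $ k * Q $ k $ j = 0"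
  proof (subst sum_nonneg_eq_0_iff[symmetric])
    fix k
    show "0 \<le> \<mu> $ k * Q $ k $ j"
      using assms
      by (cases "k = j") (auto simp: transition_rate_matrix_def steady_state_def prob_distribution_def)
  qed (use assms steady_state_column_sum in auto)
  then show ?thesis
    using assms(4) by auto
qed

lemma steady_state_pos:
  assumes Q: "transition_rate_matrix Q" "irreducible_rates Q" and \<mu>: "steady_state Q \<mu>"
  shows "0 < \<mu> $ j"
proof (rule ccontr)
  assume "\<not> 0 < \<mu> $ j"
  then have j: "\<mu> $ j = 0"
    using \<mu> by (metis steady_state_def prob_distribution_def less_eq_real_def)
  have "\<mu> $ i = 0" for i
  proof (cases "i = j")
    case False
    obtain xs where xs: "xs \<noteq> []" "hd xs = i" "last xs = j"
      "0 < (\<Prod>k<length xs - 1. Q $ (xs ! k) $ (xs ! Suc k))"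
      using Q(2) False unfolding irreducible_rates_def by meson
    have edge: "Q $ (xs ! k) $ (xs ! Suc k) \<noteq> 0" if "k < length xs - 1" for k
    proof
      assume "Q $ (xs ! k) $ (xs ! Suc k) = 0"
      then have "(\<Prod>k<length xs - 1. Q $ (xs ! k) $ (xs ! Suc k)) = 0"
        using that by (intro prod_zero) auto
      then show False
        using xs(4) by linarith
    qed
    have "\<mu> $ (xs ! k) = 0" if "k \<le> length xs - 1" for k
      using that
    \<comment> \<open>Zeros of \<open>\<mu>\<close> spread from the last state of the path back to
      the first; as \<open>i\<close> is arbitrary, total mass 1 is contradicted.\<close>
    proof (induction k rule: inc_induct)
      case base
      then show ?case
        using j xs by (simp add: last_conv_nth)
    next
      case (step k)
      then show ?case
        using steady_state_zero_backward[OF Q(1) \<mu> _ edge] by blast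
    qed
    from this[of 0] show ?thesis
      using xs by (simp add: hd_conv_nth)
  qed (use j in simp)
  then show False
    using \<mu> by (simp add: steady_state_def prob_distribution_def)
qed

section \<open>Nonnegativity of solutions of the master equation\<close>

text \<open>Squaring removes the kink at 0, where the difference quotient is at most
  \<open>\<bar>y\<bar>\<close>. This makes the energy of the negative parts differentiable.\<close>

lemma has_real_derivative_square_neg_part:
  fixes x :: real
  shows "((\<lambda>x. (min x 0)\<^sup>2) has_real_derivative 2 * min x 0) (at x)"
proof (cases x "0 :: real" rule: linorder_cases)
  case less
  have "((\<lambda>x. x\<^sup>2) has_real_derivative 2 * min x 0) (at x)"
    using less by (auto intro!: derivative_eq_intros)
  moreover have "\<forall>\<^sub>F y in nhds x. y\<^sup>2 = (min y 0)\<^sup>2"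
    using eventually_nhds_in_open[of "{..<0}" x] less by (auto elim!: eventually_mono)
  ultimately show ?thesis
    by (subst (asm) DERIV_cong_ev) auto
next
  case greater
  have "((\<lambda>x. 0) has_real_derivative 2 * min x 0) (at x)"
    using greater by auto
  moreover have "\<forall>\<^sub>F y in nhds x. 0 = (min y 0)\<^sup>2"
    using eventually_nhds_in_open[of "{0<..}" x] greater by (auto elim!: eventually_mono)
  ultimately show ?thesis
    by (subst (asm) DERIV_cong_ev) auto
next
  case equal
  have "((\<lambda>y::real. (min y 0)\<^sup>2 / y) \<longlongrightarrow> 0) (at 0)"
  proof (rule Lim_null_comparison)
    show "\<forall>\<^sub>F y in at (0::real). norm ((min y 0)\<^sup>2 / y) \<le> \<bar>y\<bar>"
      by (intro always_eventually allI) (auto simp: min_def power2_eq_square)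
    show "((\<lambda>y::real. \<bar>y\<bar>) \<longlongrightarrow> 0) (at 0)"
      by (intro tendsto_eq_intros) auto
  qed
  then show ?thesis
    using equal by (simp add: has_field_derivative_iff)
qed

text \<open>
  Gronwall for the energy \<open>\<Sum>\<^sub>i (min p\<^sub>i 0)\<^sup>2\<close>, which vanishes initially and grows at most
  exponentially.
\<close>

lemma master_solution_nonneg:
  fixes Q :: "real^'n^'n"
  assumes Q: "transition_rate_matrix Q" and p: "master_solution Q p"
    and p0: "\<And>i. 0 \<le> p 0 $ i" and t: "0 \<le> t"
  shows "0 \<le> p t $ i"
proof -
  define m where "m s i = min (p s $ i) 0" for s i
  define E where "E s = (\<Sum>i\<in>UNIV. (m s i)\<^sup>2)" for s
  define B where "B = (\<Sum>i\<in>UNIV. \<Sum>j\<in>UNIV. \<bar>Q $ j $ i\<bar>)"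
  define E' where "E' s = (\<Sum>i\<in>UNIV. 2 * m s i * (\<Sum>j\<in>UNIV. p s $ j * Q $ j $ i))" for s
  have dp: "((\<lambda>s. p s $ i) has_real_derivative (\<Sum>j\<in>UNIV. p s $ j * Q $ j $ i)) (at s within {0..})"
    if "0 \<le> s" for s i
  proof -
    have "((\<lambda>s. p s $ i) has_vector_derivative (p s v* Q) $ i) (at s within {0..})"
      using p that unfolding master_solution_def
      by (intro bounded_linear.has_vector_derivative[OF bounded_linear_vec_nth]) auto
    then show ?thesis
      by (simp add: has_real_derivative_iff_has_vector_derivative vector_matrix_mult_def mult.commute)
  qed
  have dE: "(E has_real_derivative E' s) (at s within {0..})" if "0 \<le> s" for s
    unfolding E_def E'_def m_def
    by (intro DERIV_sum DERIV_chain2[OF has_real_derivative_square_neg_part] dp that)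
  have le: "E' s \<le> 2 * B * E s" for s
  proof -
    have "m s i * (p s $ j * Q $ j $ i) \<le> \<bar>Q $ j $ i\<bar> * E s" for i j
    proof -
      have sq: "(m s k)\<^sup>2 \<le> E s" for k
        unfolding E_def by (rule member_le_sum) auto
      \<comment> \<open>Off the diagonal the rate is nonnegative, \<open>m s j \<le> p s $ j\<close>
        and \<open>m s i \<le> 0\<close>; on it both sides agree.\<close>
      have "m s i * (p s $ j * Q $ j $ i) \<le> m s i * (m s j * Q $ j $ i)"
      proof (cases "i = j")
        case True
        then show ?thesis by (simp add: m_def min_def)
      next
        case False
        then have "0 \<le> Q $ j $ i"
          using Q by (auto simp: transition_rate_matrix_def)
        then show ?thesis
          by (intro mult_left_mono_neg mult_right_mono) (auto simp: m_def)
      qed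
      also have "\<dots> \<le> \<bar>Q $ j $ i\<bar> * \<bar>m s i * m s j\<bar>"
        by (metis abs_ge_self abs_mult mult.assoc mult.commute)
      also have "\<bar>m s i * m s j\<bar> \<le> E s"
        using sq[of i] sq[of j] sum_squares_bound[of "\<bar>m s i\<bar>" "\<bar>m s j\<bar>"]
        by (simp add: abs_mult)
      finally show ?thesis
        by (simp add: mult_left_mono)
    qed
    then have "(\<Sum>i\<in>UNIV. \<Sum>j\<in>UNIV. m s i * (p s $ j * Q $ j $ i))
        \<le> (\<Sum>i\<in>UNIV. \<Sum>j\<in>UNIV. \<bar>Q $ j $ i\<bar> * E s)"
      by (intro sum_mono)
    moreover have "E' s = 2 * (\<Sum>i\<in>UNIV. \<Sum>j\<in>UNIV. m s i * (p s $ j * Q $ j $ i))"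
      by (simp add: E'_def sum_distrib_left mult.assoc)
    moreover have "B * E s = (\<Sum>i\<in>UNIV. \<Sum>j\<in>UNIV. \<bar>Q $ j $ i\<bar> * E s)"
      by (simp add: B_def sum_distrib_right)
    ultimately show ?thesis
      by linarith
  qed
  \<comment> \<open>The integrating factor turns \<open>E' \<le> 2 * B * E\<close> into monotonicity
    of \<open>F\<close>.\<close>
  define F where "F s = exp (- (2 * B) * s) * E s" for s
  have dF: "(F has_real_derivative exp (- (2 * B) * s) * (E' s - 2 * B * E s)) (at s within {0..})"
    if "0 \<le> s" for s
    unfolding F_def
    by (auto intro!: derivative_eq_intros dE that simp: algebra_simps)
  have "F t \<le> F 0"
  \<comment> \<open>At 0 the derivative is only one-sided; continuity covers the end points.\<close>
  proof (rule DERIV_nonpos_imp_decreasing_open[OF t])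
    fix s assume s: "0 < s" "s < t"
    then have "(F has_real_derivative exp (- (2 * B) * s) * (E' s - 2 * B * E s)) (at s)"
      using dF[of s] at_within_interior[of s "{0..}"] by simp
    moreover have "exp (- (2 * B) * s) * (E' s - 2 * B * E s) \<le> 0"
      using le[of s] by (intro mult_nonneg_nonpos) auto
    ultimately show "\<exists>y. (F has_real_derivative y) (at s) \<and> y \<le> 0"
      by blast
  next
    show "continuous_on {0..t} F"
      by (rule DERIV_continuous_on, rule DERIV_subset[OF dF]) auto
  qed
  moreover have "F 0 = 0"
    using p0 by (simp add: F_def E_def m_def)
  ultimately have "E t \<le> 0"
    by (simp add: F_def mult_le_0_iff)
  then have "E t = 0"
    unfolding E_def by (intro antisym sum_nonneg) auto
  then have "m t i = 0"
    by (simp add: E_def sum_nonneg_eq_0_iff)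
  then show ?thesis
    by (simp add: m_def min_def split: if_splits)
qed

section \<open>Lower bound for the adiabatic entropy production rate\<close>

text \<open>
  Where one of the two fluxes vanishes, \<open>l\<close> is set to the junk value \<open>0\<close>. This is harmless: a
  finite rate forces \<open>p\<^sub>i = 0\<close> as soon as some \<open>a\<^sub>i\<^sub>j > 0 = a\<^sub>j\<^sub>i\<close>.
\<close>

lemma adiabatic_ep_ge:
  fixes Q :: "real^'n^'n"
  assumes Q: "transition_rate_matrix Q" and \<mu>: "steady_state Q \<mu>"
    and pos: "\<And>k. 0 < \<mu> $ k" and p: "\<And>k. 0 \<le> p $ k"
    and M: "0 < M" "\<And>i j. Q $ i $ j \<le> M"
  shows "ereal (1 / (4 * M) * (\<Sum>i\<in>UNIV. \<Sum>j\<in>UNIV. p $ i * (\<mu> $ i * Q $ i $ j - \<mu> $ j * Q $ j $ i)\<^sup>2))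
    \<le> adiabatic_ep Q \<mu> p"
proof -
  define a where "a i j = \<mu> $ i * Q $ i $ j" for i j
  define T where "T i j = ereal (p $ i * Q $ i $ j - p $ j * Q $ j $ i) * log_ratio (a i j) (a j i)" for i j
  have ep: "adiabatic_ep Q \<mu> p = ereal (1 / 2) * (\<Sum>i\<in>UNIV. \<Sum>j\<in>UNIV. T i j)"
    by (simp add: adiabatic_ep_def T_def a_def)
  have T_not: "T i j \<noteq> - \<infinity>" for i j
    unfolding T_def a_def by (rule adiabatic_summand_not_MInfty[OF Q pos p])
  have a_nonneg: "0 \<le> a i j" if "i \<noteq> j" for i j
    using Q that pos[of i] by (auto simp: a_def transition_rate_matrix_def)
  have \<mu>1: "\<mu> $ i \<le> 1" for i
    using \<mu> member_le_sum[of i UNIV "\<lambda>i. \<mu> $ i"]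
    by (auto simp: steady_state_def prob_distribution_def)
  have aM: "a i j \<le> M" for i j
  proof (cases "0 \<le> Q $ i $ j")
    case True
    then have "a i j \<le> 1 * Q $ i $ j"
      unfolding a_def using \<mu>1 by (intro mult_right_mono) auto
    then show ?thesis using M(2)[of i j] by linarith
  next
    case False
    then have "a i j \<le> 0"
      using pos[of i] by (simp add: a_def mult_nonneg_nonpos)
    then show ?thesis using M(1) by linarith
  qed
  show ?thesis
  proof (cases "\<exists>i j. T i j = \<infinity>")
    case True
    then have "(\<Sum>i\<in>UNIV. \<Sum>j\<in>UNIV. T i j) = \<infinity>"
      by (auto simp: sum_Pinfty)
    then show ?thesis
      by (simp add: ep)
  next
    case False
    define l where "l i j = (if a i j = 0 \<or> a j i = 0 then 0 else ln (a i j / a j i))" for i j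
    define x where "x i = p $ i / \<mu> $ i" for i
    have px: "p $ i * Q $ i $ j = x i * a i j" for i j
      using pos[of i] by (simp add: x_def a_def)
    have no_flux: "p $ i = 0" if "a i j \<noteq> 0" "a j i = 0" for i j
    proof (rule ccontr)
      assume "p $ i \<noteq> 0"
      moreover have "Q $ j $ i = 0"
        using that(2) pos[of j] by (simp add: a_def)
      moreover have "0 < Q $ i $ j"
        using that a_nonneg[of i j] pos[of i]
        by (cases "i = j") (auto simp: a_def zero_le_mult_iff less_le)
      ultimately have "T i j = \<infinity>"
        using that p[of i] by (simp add: T_def log_ratio_def less_le)
      then show False using False by blast
    qed
    \<comment> \<open>If exactly one flux vanishes, \<open>no_flux\<close> makes the coefficient 0,
      and \<open>0 * \<infinity> = 0\<close> agrees with the value 0 of \<open>l\<close>.\<close>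
    have Tl: "T i j = ereal ((x i * a i j - x j * a j i) * l i j)" for i j
      using no_flux[of i j] no_flux[of j i]
      by (auto simp: T_def log_ratio_def l_def px x_def)
    have l_anti: "l j i = - l i j" for i j
    proof (cases "i = j")
      case False
      then show ?thesis
        using a_nonneg[of i j] a_nonneg[of j i] by (auto simp: l_def ln_div)
    qed (simp add: l_def)
    have row: "(\<Sum>j\<in>UNIV. a i j) = 0" for i
      using rate_row_sum[OF Q, of i] by (simp add: a_def flip: sum_distrib_left)
    have col: "(\<Sum>j\<in>UNIV. a j i) = 0" for i
      using steady_state_column_sum[OF \<mu>] by (simp add: a_def)
    have summand: "x i * ((a i j - a j i)\<^sup>2 / (4 * M)) \<le> x i * (a i j * l i j - a i j + a j i)" for i j
    \<comment> \<open>The case \<open>p $ i = 0\<close> is split off because the inequality without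
      the weight \<open>x i\<close> fails when \<open>a i j > 0 = a j i\<close>.\<close>
    proof (cases "i = j \<or> p $ i = 0")
      case True
      then show ?thesis by (auto simp: l_def x_def)
    next
      case False
      have "(a i j - a j i)\<^sup>2 / (4 * M) \<le> a i j * l i j - a i j + a j i"
      proof (cases "a i j = 0")
        case True
        have "a j i * a j i \<le> a j i * (4 * M)"
          using a_nonneg[of j i] False aM[of j i] M(1) by (intro mult_left_mono) auto
        then show ?thesis
          using True M(1) by (simp add: power2_eq_square divide_le_eq)
      next
        case nz: False
        then have "a j i \<noteq> 0"
          using no_flux False by blast
        then have "0 < a i j" "0 < a j i"
          using nz False a_nonneg[of i j] a_nonneg[of j i] by (auto simp: less_le)
        then show ?thesis
          using relative_entropy_ge_square[of "a i j" "a j i" M] aM by (simp add: l_def)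
      qed
      then show ?thesis
        using p[of i] pos[of i] by (intro mult_left_mono) (auto simp: x_def)
    qed
    have "1 / (4 * M) * (\<Sum>i\<in>UNIV. \<Sum>j\<in>UNIV. p $ i * (a i j - a j i)\<^sup>2)
        = (\<Sum>i\<in>UNIV. \<Sum>j\<in>UNIV. p $ i * ((a i j - a j i)\<^sup>2 / (4 * M)))"
      by (simp add: sum_distrib_left)
    also have "\<dots> \<le> (\<Sum>i\<in>UNIV. \<Sum>j\<in>UNIV. x i * (a i j * l i j - a i j + a j i))"
    proof (intro sum_mono)
      fix i j
      have "p $ i * 1 \<le> p $ i * (1 / \<mu> $ i)"
        using p[of i] pos[of i] \<mu>1[of i] by (intro mult_left_mono) (auto simp: divide_simps)
      then have "p $ i * ((a i j - a j i)\<^sup>2 / (4 * M)) \<le> x i * ((a i j - a j i)\<^sup>2 / (4 * M))"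
        using M(1) by (intro mult_right_mono) (auto simp: x_def)
      then show "p $ i * ((a i j - a j i)\<^sup>2 / (4 * M)) \<le> x i * (a i j * l i j - a i j + a j i)"
        using summand[of i j] by linarith
    qed
    \<comment> \<open>The weight \<open>x i\<close> does not depend on \<open>j\<close>, so the
      corrections cancel by the zero row and column sums.\<close>
    also have "\<dots> = (\<Sum>i\<in>UNIV. \<Sum>j\<in>UNIV. x i * a i j * l i j)"
    proof (rule sum.cong[OF refl])
      fix i
      have "(\<Sum>j\<in>UNIV. x i * (a i j * l i j - a i j + a j i))
          = x i * ((\<Sum>j\<in>UNIV. a i j * l i j) - (\<Sum>j\<in>UNIV. a i j) + (\<Sum>j\<in>UNIV. a j i))"
        by (simp only: sum_distrib_left[symmetric] sum.distrib sum_subtractf)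
      then show "(\<Sum>j\<in>UNIV. x i * (a i j * l i j - a i j + a j i)) = (\<Sum>j\<in>UNIV. x i * a i j * l i j)"
        by (simp add: row col sum_distrib_left mult.assoc)
    qed
    also have "\<dots> = 1 / 2 * (\<Sum>i\<in>UNIV. \<Sum>j\<in>UNIV. (x i * a i j - x j * a j i) * l i j)"
      by (subst sum_antisymmetric_mult[where u = "\<lambda>i j. x i * a i j", OF l_anti]) simp
    finally show ?thesis
      unfolding ep Tl a_def[symmetric] by simp
  qed
qed

section \<open>A constant depending only on the rates\<close>

theorem theorem3p7:
  fixes Q :: "real^'n^'n"
  assumes "transition_rate_matrix Q" and "irreducible_rates Q"
  shows "\<exists>c\<^sub>2>0. \<forall>\<mu> p. steady_state Q \<mu> \<longrightarrow> master_solution Q p \<longrightarrow> prob_distribution (p 0) \<longrightarrow>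
    (\<forall>t\<ge>0. adiabatic_ep Q \<mu> (p t) \<ge>
       ereal (c\<^sub>2 * (\<Sum>i\<in>UNIV. \<Sum>j\<in>UNIV. p t $ i * (\<mu> $ i * Q $ i $ j - \<mu> $ j * Q $ j $ i)\<^sup>2)))"
proof -
  \<comment> \<open>The summand 1 keeps \<open>M\<close> positive even for a single state, where
    \<open>Q = 0\<close>. The witness is \<open>1 / (4 * M)\<close>, fixed before
    \<open>\<mu>\<close> and \<open>p\<close>.\<close>
  define M where "M = 1 + (\<Sum>i\<in>UNIV. \<Sum>j\<in>UNIV. \<bar>Q $ i $ j\<bar>)"
  have M_pos: "0 < M"
    unfolding M_def by (intro add_pos_nonneg sum_nonneg) auto
  have M_ge: "Q $ i $ j \<le> M" for i j
  proof -
    have "Q $ i $ j \<le> \<bar>Q $ i $ j\<bar>" by simp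
    also have "\<dots> \<le> (\<Sum>j\<in>UNIV. \<bar>Q $ i $ j\<bar>)"
      by (rule member_le_sum) auto
    also have "\<dots> \<le> (\<Sum>i\<in>UNIV. \<Sum>j\<in>UNIV. \<bar>Q $ i $ j\<bar>)"
      by (rule member_le_sum[where f = "\<lambda>i. \<Sum>j\<in>UNIV. \<bar>Q $ i $ j\<bar>"]) (auto intro: sum_nonneg)
    finally show ?thesis by (simp add: M_def)
  qed
  show ?thesis
  proof (intro exI[of _ "1 / (4 * M)"] conjI allI impI)
    show "0 < 1 / (4 * M)" using M_pos by simp
  next
    fix \<mu> p and t :: real
    assume sol: "steady_state Q \<mu>" "master_solution Q p" "prob_distribution (p 0)" "0 \<le> t"
    have "0 < \<mu> $ k" for k
      by (rule steady_state_pos[OF assms sol(1)])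
    moreover have "0 \<le> p t $ k" for k
      using master_solution_nonneg[OF assms(1) sol(2) _ sol(4)] sol(3)
      by (simp add: prob_distribution_def)
    ultimately show "ereal (1 / (4 * M) * (\<Sum>i\<in>UNIV. \<Sum>j\<in>UNIV. p t $ i * (\<mu> $ i * Q $ i $ j - \<mu> $ j * Q $ j $ i)\<^sup>2))
        \<le> adiabatic_ep Q \<mu> (p t)"
      by (intro adiabatic_ep_ge[OF assms(1) sol(1) _ _ M_pos M_ge])
  qed
qed

end
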